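(* Let $t\ge 1$ be an integer and $d=2t+1$. Let a stabilizer code and a logical Pauli operator $L$ of it be given, together with LM components for $L$, QEC components fault-tolerant to distance $d$, and QED components fault-tolerant to distance $d$ (all defined in the context). Consider the procedure that applies an LM component followed by $(d-1)/2$ iterations of the sequence QED, LM, QEC, LM. Then this procedure (the LM and QED outcomes being processed by a suitable classical decoder that outputs the value of the logical measurement) is a procedure for measuring the single logical operator $L$ that is fault-tolerant to distance $d$.
   Context: Errors: an error is either an undesired Pauli operator at a circuit location or a flip of a measurement result. For a circuit (procedure or component), errors present on the data qubits before it starts are input errors, errors occurring during it are internal errors, and the resulting data error at its end is the output error. The $X$ weight (resp. $Z$ weight) of a Pauli operator is the number of qubits on which it acts as $X$ or $Y$ (resp. $Z$ or $Y$). A data error has weight at most $s$ if some representative of it modulo stabilizers has both $X$ weight and $Z$ weight at most $s$; the number of input errors is the least such $s$. Circuit-level errors: any $n$-qubit Pauli error may occur after an $n$-qubit gate, any single-qubit Pauli error after a state preparation, and a classical bit flip on a measurement outcome; each counts as one error. Fault-tolerant logical measurement procedure: a (non-destructive) procedure for measuring a single logical operator is fault-tolerant to distance $d=2t+1$ if, provided the number of input errors plus internal errors is at most $t$, the measurement outcome is correct and the output error weight is at most $t$. LM (logical measurement) component: a single measurement of the logical operator $L$ implemented by a fault-tolerant syndrome extraction circuit, i.e. a circuit measuring $L$ with one (classical) outcome, such that any $w$ circuit-level errors in it, propagated to its end, result in a data error with $X$ weight and $Z$ weight at most $w$. Without internal errors its outcome is the true value of $L$, flipped exactly when the incoming data error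 anticommutes with $L$; incoming data errors remain on the data qubits. QEC component: a quantum error correction procedure fault-tolerant to distance $d=2t+1$: provided the number of input errors plus the number of internal errors is at most $t$, both the $X$ weight and the $Z$ weight of its output error (minimized over stabilizer-equivalent representatives) are at most the number of internal errors. QED component: an error detection procedure fault-tolerant to distance $d=2t+1$, with a one-bit outcome (error detected or not): provided the number of input errors is at most $t$ and there are no internal errors, it detects that an error has occurred (if there is a nontrivial input error); the output error weight is at most the number of internal plus input errors. In the absence of any input and internal errors it reports no error. *)

theory Defs
  imports "HOL-Analysis.Analysis"
begin

section \<open>Pauli operators\<close>

text \<open>
  Qubits are labelled by a finite type. A computational basis vector is a bit assignment
  \<open>'q \<Rightarrow> bool\<close>; states and operators are complex vectors and matrices indexed by these.
\<close>

type_synonym 'q state = "complex ^ ('q \<Rightarrow> bool)"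
type_synonym 'q operator = "complex ^ ('q \<Rightarrow> bool) ^ ('q \<Rightarrow> bool)"

datatype pauli1 = PI | PX | PY | PZ

type_synonym 'q pauli = "'q \<Rightarrow> pauli1"

fun pauli1_entry :: "pauli1 \<Rightarrow> bool \<Rightarrow> bool \<Rightarrow> complex" where
  "pauli1_entry PI i j = (if i = j then 1 else 0)"
| "pauli1_entry PX i j = (if i = j then 0 else 1)"
| "pauli1_entry PY i j = (if i = j then 0 else if i then \<i> else - \<i>)"
| "pauli1_entry PZ i j = (if i = j then (if i then -1 else 1) else 0)"

definition pauli_op :: "('q::finite) pauli \<Rightarrow> 'q operator" where
  "pauli_op P = (\<chi> s s'. \<Prod>q\<in>UNIV. pauli1_entry (P q) (s q) (s' q))"

definition x_weight :: "('q::finite) pauli \<Rightarrow> nat" where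
  "x_weight P = card {q. P q \<in> {PX, PY}}"

definition z_weight :: "('q::finite) pauli \<Rightarrow> nat" where
  "z_weight P = card {q. P q \<in> {PZ, PY}}"

definition pauli_group :: "('q::finite) operator set" where
  "pauli_group = {mat k ** pauli_op P | k P. k \<in> {1, -1, \<i>, - \<i>}}"

definition anticommutes :: "('q::finite) operator \<Rightarrow> 'q operator \<Rightarrow> bool" where
  "anticommutes A B \<longleftrightarrow> A ** B = - (B ** A)"

section \<open>Stabilizer codes, logical operators, data errors\<close>

definition stabilizer_group :: "('n::finite) operator set \<Rightarrow> bool" where
  "stabilizer_group S \<longleftrightarrow>
     S \<subseteq> pauli_group \<and> mat 1 \<in> S \<and> - mat 1 \<notin> S \<and>
     (\<forall>g\<in>S. \<forall>h\<in>S. g ** h \<in> S \<and> g ** h = h ** g)"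

definition code_space :: "('n::finite) operator set \<Rightarrow> 'n state set" where
  "code_space S = {\<psi>. \<forall>g\<in>S. g *v \<psi> = \<psi>}"

definition logical_pauli :: "('n::finite) operator set \<Rightarrow> 'n operator \<Rightarrow> bool" where
  "logical_pauli S L \<longleftrightarrow> L \<in> pauli_group \<and> L ** L = mat 1 \<and> (\<forall>g\<in>S. g ** L = L ** g)"

text \<open>
  The value \<open>False\<close> of the observable \<open>L\<close> stands for the eigenvalue \<open>1\<close>, and \<open>True\<close> for the
  eigenvalue \<open>-1\<close>; the following is the projector onto the respective eigenspace.
\<close>

definition eigenprojector :: "('n::finite) operator \<Rightarrow> bool \<Rightarrow> 'n operator" where
  "eigenprojector L b = mat (1/2) ** (if b then mat 1 - L else mat 1 + L)"

definition stab_equiv :: "('n::finite) operator set \<Rightarrow> 'n pauli \<Rightarrow> 'n pauli \<Rightarrow> bool" where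
  "stab_equiv S E E' \<longleftrightarrow>
     (\<exists>g\<in>S. \<exists>k\<in>{1, -1, \<i>, - \<i>}. pauli_op E = mat k ** (g ** pauli_op E'))"

text \<open>A single representative has to be light in both the \<open>X\<close> and the \<open>Z\<close> sense.\<close>

definition err_weight :: "('n::finite) operator set \<Rightarrow> 'n pauli \<Rightarrow> nat" where
  "err_weight S E = (LEAST s. \<exists>E'. stab_equiv S E E' \<and> x_weight E' \<le> s \<and> z_weight E' \<le> s)"

section \<open>Circuits with circuit-level errors\<close>

text \<open>
  \<open>Gate A U C\<close> applies \<open>U\<close> to the qubits in \<open>A\<close> (an idle location is a gate with \<open>U = mat 1\<close>),
  \<open>Prep q v C\<close> resets the qubit \<open>q\<close> to the pure state \<open>v\<close>, and \<open>Meas q B C\<close> measures \<open>q\<close> in the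
  orthonormal basis \<open>B False, B True\<close>. The rest of the circuit may depend on the recorded
  measurement outcome, so adaptive circuits with classical processing are included; \<open>Return r\<close>
  ends the circuit with classical outcome \<open>r\<close>.
\<close>

datatype ('q::finite, 'r) circuit =
    Return 'r
  | Gate "'q set" "complex ^ ('q \<Rightarrow> bool) ^ ('q \<Rightarrow> bool)" "('q, 'r) circuit"
  | Prep 'q "bool \<Rightarrow> complex" "('q, 'r) circuit"
  | Meas 'q "bool \<Rightarrow> bool \<Rightarrow> complex" "bool \<Rightarrow> ('q, 'r) circuit"

primrec then_circuit ::
    "('q::finite, 'r) circuit \<Rightarrow> ('r \<Rightarrow> ('q, 's) circuit) \<Rightarrow> ('q, 's) circuit" where
  "then_circuit (Return r) D = D r"
| "then_circuit (Gate A U C) D = Gate A U (then_circuit C D)"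
| "then_circuit (Prep q v C) D = Prep q v (then_circuit C D)"
| "then_circuit (Meas q B C) D = Meas q B (\<lambda>b. then_circuit (C b) D)"

definition adjoint_op :: "('q::finite) operator \<Rightarrow> 'q operator" where
  "adjoint_op U = (\<chi> s s'. cnj (U $ s' $ s))"

definition unitary_op :: "('q::finite) operator \<Rightarrow> bool" where
  "unitary_op U \<longleftrightarrow> U ** adjoint_op U = mat 1 \<and> adjoint_op U ** U = mat 1"

text \<open>\<open>U\<close> is the tensor product of some operator \<open>u\<close> on \<open>A\<close> and the identity elsewhere.\<close>

definition acts_on :: "'q set \<Rightarrow> ('q::finite) operator \<Rightarrow> bool" where
  "acts_on A U \<longleftrightarrow> (\<exists>u. \<forall>s s'. U $ s $ s' =
     (if \<forall>q. q \<notin> A \<longrightarrow> s q = s' q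
      then u (\<lambda>q. q \<in> A \<and> s q) (\<lambda>q. q \<in> A \<and> s' q) else 0))"

definition on_qubit :: "'q \<Rightarrow> (bool \<Rightarrow> bool \<Rightarrow> complex) \<Rightarrow> ('q::finite) operator" where
  "on_qubit q M = (\<chi> s s'. if \<forall>p. p \<noteq> q \<longrightarrow> s p = s' p then M (s q) (s' q) else 0)"

primrec wf_circuit :: "('q::finite, 'r) circuit \<Rightarrow> bool" where
  "wf_circuit (Return r) \<longleftrightarrow> True"
| "wf_circuit (Gate A U C) \<longleftrightarrow> unitary_op U \<and> acts_on A U \<and> wf_circuit C"
| "wf_circuit (Prep q v C) \<longleftrightarrow> (\<Sum>i\<in>UNIV. v i * cnj (v i)) = 1 \<and> wf_circuit C"
| "wf_circuit (Meas q B C) \<longleftrightarrow>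
     (\<forall>b b'. (\<Sum>i\<in>UNIV. B b i * cnj (B b' i)) = (if b = b' then 1 else 0)) \<and>
     (\<forall>b. wf_circuit (C b))"

text \<open>
  The Kraus operators of a reset are \<open>|v><j|\<close> for \<open>j \<in> {0, 1}\<close>, those of a measurement are the
  projectors \<open>|B b><B b|\<close>.
\<close>

definition prep_op :: "'q \<Rightarrow> (bool \<Rightarrow> complex) \<Rightarrow> bool \<Rightarrow> ('q::finite) operator" where
  "prep_op q v j = on_qubit q (\<lambda>i i'. if i' = j then v i else 0)"

definition meas_op :: "'q \<Rightarrow> (bool \<Rightarrow> complex) \<Rightarrow> ('q::finite) operator" where
  "meas_op q f = on_qubit q (\<lambda>i i'. f i * cnj (f i'))"

text \<open>Nontrivial Pauli operators that act only on the qubits in \<open>A\<close>.\<close>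

definition faults_on :: "'q set \<Rightarrow> ('q::finite) pauli set" where
  "faults_on A = {P. P \<noteq> (\<lambda>q. PI) \<and> (\<forall>q. q \<notin> A \<longrightarrow> P q = PI)}"

text \<open>
  \<open>exec C w r K\<close>: the circuit \<open>C\<close> has a run with exactly \<open>w\<close> internal errors and classical
  outcome \<open>r\<close>, in which the joint state of all qubits undergoes the (unnormalized) linear map \<open>K\<close>.
  A run has probability zero on an initial state iff \<open>K\<close> annihilates that state.
\<close>

inductive exec :: "('q::finite, 'r) circuit \<Rightarrow> nat \<Rightarrow> 'r \<Rightarrow> 'q operator \<Rightarrow> bool" where
  Return: "exec (Return r) 0 r (mat 1)"
| Gate: "exec C w r K \<Longrightarrow> exec (Gate A U C) w r (K ** U)"
| Gate_fault: "exec C w r K \<Longrightarrow> P \<in> faults_on A \<Longrightarrow>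
    exec (Gate A U C) (Suc w) r (K ** (pauli_op P ** U))"
| Prep: "exec C w r K \<Longrightarrow> exec (Prep q v C) w r (K ** prep_op q v j)"
| Prep_fault: "exec C w r K \<Longrightarrow> P \<in> faults_on {q} \<Longrightarrow>
    exec (Prep q v C) (Suc w) r (K ** (pauli_op P ** prep_op q v j))"
| Meas: "exec (C b) w r K \<Longrightarrow> exec (Meas q B C) w r (K ** meas_op q (B b))"
| Meas_fault: "exec (C (\<not> b)) w r K \<Longrightarrow> exec (Meas q B C) (Suc w) r (K ** meas_op q (B b))"

section \<open>Components\<close>

text \<open>
  Circuits act on the data qubits \<open>'n\<close> and ancilla qubits \<open>'a\<close>. Ancillas have to be prepared by
  the circuit itself: specifications quantify over the initial ancilla state \<open>\<phi>\<close>.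
\<close>

definition tensor :: "('n::finite) state \<Rightarrow> ('a::finite) state \<Rightarrow> ('n + 'a) state" where
  "tensor \<psi> \<phi> = (\<chi> s. \<psi> $ (\<lambda>q. s (Inl q)) * \<phi> $ (\<lambda>q. s (Inr q)))"

text \<open>
  On code states with data error \<open>E\<close>, the run with linear map \<open>K\<close> performs the ideal operation \<open>A\<close>
  on the encoded state and leaves the data error \<open>E'\<close>. The final ancilla state \<open>\<phi>'\<close> absorbs
  phase and normalization; \<open>\<phi>' = 0\<close> means that the run does not occur. Neither \<open>E'\<close> nor \<open>\<phi>'\<close>
  depends on the encoded state, so superpositions and entanglement of the encoded state with other
  systems are respected.
\<close>

definition run_effect ::
    "('n::finite) operator set \<Rightarrow> ('n + 'a::finite) operator \<Rightarrow> 'n operator \<Rightarrow> 'a state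
      \<Rightarrow> 'n operator \<Rightarrow> 'n operator \<Rightarrow> bool" where
  "run_effect S K E \<phi> A E' \<longleftrightarrow>
     (\<exists>\<phi>'. \<forall>\<psi>\<in>code_space S. K *v tensor (E *v \<psi>) \<phi> = tensor (E' *v (A *v \<psi>)) \<phi>')"

definition run_impossible ::
    "('n::finite) operator set \<Rightarrow> ('n + 'a::finite) operator \<Rightarrow> 'n operator \<Rightarrow> 'a state \<Rightarrow> bool" where
  "run_impossible S K E \<phi> \<longleftrightarrow> (\<forall>\<psi>\<in>code_space S. K *v tensor (E *v \<psi>) \<phi> = 0)"

text \<open>
  Here \<open>c\<close> is the eigenvalue of \<open>L\<close> that the run projects the encoded state onto (the true value),
  and \<open>F\<close> is the data error caused by the internal errors. If \<open>w = 0\<close>, then \<open>F\<close> has weight \<open>0\<close>,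
  i.e., it is a stabilizer up to phase.
\<close>

definition lm_component ::
    "('n::finite) operator set \<Rightarrow> 'n operator \<Rightarrow> ('n + 'a::finite, bool) circuit \<Rightarrow> bool" where
  "lm_component S L C \<longleftrightarrow> wf_circuit C \<and>
     (\<forall>w r K E \<phi>. exec C w r K \<longrightarrow>
        (\<exists>c F. err_weight S F \<le> w \<and>
           run_effect S K (pauli_op E) \<phi> (eigenprojector L c) (pauli_op F ** pauli_op E) \<and>
           (w = 0 \<longrightarrow> r = (c \<noteq> anticommutes (pauli_op E) L))))"

text \<open>Fault tolerance to distance \<open>2 * t + 1\<close> is expressed in terms of \<open>t\<close>.\<close>

definition qec_component ::
    "('n::finite) operator set \<Rightarrow> nat \<Rightarrow> ('n + 'a::finite, unit) circuit \<Rightarrow> bool" where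
  "qec_component S t C \<longleftrightarrow> wf_circuit C \<and>
     (\<forall>w r K E \<phi>. exec C w r K \<and> err_weight S E + w \<le> t \<longrightarrow>
        (\<exists>E'. err_weight S E' \<le> w \<and>
           run_effect S K (pauli_op E) \<phi> (mat 1) (pauli_op E')))"

text \<open>
  The outcome \<open>True\<close> means that an error is detected. A data error is trivial (a stabilizer up to
  phase) iff its weight is \<open>0\<close>.
\<close>

definition qed_component ::
    "('n::finite) operator set \<Rightarrow> nat \<Rightarrow> ('n + 'a::finite, bool) circuit \<Rightarrow> bool" where
  "qed_component S t C \<longleftrightarrow> wf_circuit C \<and>
     (\<forall>w r K E \<phi>. exec C w r K \<longrightarrow>
        (err_weight S E + w \<le> t \<longrightarrow>
           (\<exists>E'. err_weight S E' \<le> err_weight S E + w \<and>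
              run_effect S K (pauli_op E) \<phi> (mat 1) (pauli_op E'))) \<and>
        (w = 0 \<and> 0 < err_weight S E \<and> err_weight S E \<le> t \<and> \<not> r \<longrightarrow>
           run_impossible S K (pauli_op E) \<phi>) \<and>
        (w = 0 \<and> err_weight S E = 0 \<and> r \<longrightarrow>
           run_impossible S K (pauli_op E) \<phi>))"

section \<open>Logical measurement procedures\<close>

text \<open>
  Correctness of the outcome \<open>r\<close>: the run projects the encoded state (without its input error)
  onto the eigenspace of \<open>L\<close> with value \<open>r\<close>.
\<close>

definition ft_logical_measurement ::
    "('n::finite) operator set \<Rightarrow> 'n operator \<Rightarrow> nat \<Rightarrow> ('n + 'a::finite, bool) circuit \<Rightarrow> bool"
  where
  "ft_logical_measurement S L t C \<longleftrightarrow> wf_circuit C \<and>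
     (\<forall>w r K E \<phi>. exec C w r K \<and> err_weight S E + w \<le> t \<longrightarrow>
        (\<exists>E'. err_weight S E' \<le> t \<and>
           run_effect S K (pauli_op E) \<phi> (eigenprojector L r) (pauli_op E')))"

text \<open>
  One LM component followed by \<open>k\<close> iterations of QED, LM, QEC, LM, returning the LM and QED
  outcomes in temporal order. The components at different places may be different circuits.
\<close>

primrec lm_qed_rounds ::
    "(nat \<Rightarrow> ('q::finite, bool) circuit) \<Rightarrow> (nat \<Rightarrow> ('q, bool) circuit) \<Rightarrow>
     (nat \<Rightarrow> ('q, unit) circuit) \<Rightarrow> nat \<Rightarrow> ('q, bool list) circuit" where
  "lm_qed_rounds LM QED QEC 0 = then_circuit (LM 0) (\<lambda>m. Return [m])"
| "lm_qed_rounds LM QED QEC (Suc k) =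
     then_circuit (lm_qed_rounds LM QED QEC k) (\<lambda>h.
     then_circuit (QED k) (\<lambda>e.
     then_circuit (LM (2 * k + 1)) (\<lambda>m.
     then_circuit (QEC k) (\<lambda>_.
     then_circuit (LM (2 * k + 2)) (\<lambda>m'.
     Return (h @ [e, m, m']))))))"

definition decoded_procedure ::
    "(nat \<Rightarrow> ('q::finite, bool) circuit) \<Rightarrow> (nat \<Rightarrow> ('q, bool) circuit) \<Rightarrow>
     (nat \<Rightarrow> ('q, unit) circuit) \<Rightarrow> nat \<Rightarrow> (bool list \<Rightarrow> bool) \<Rightarrow> ('q, bool) circuit" where
  "decoded_procedure LM QED QEC k decoder =
     then_circuit (lm_qed_rounds LM QED QEC k) (\<lambda>h. Return (decoder h))"

end

theory Submission
  imports Defs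
begin

text \<open>
  A run that occurs with nonzero probability projects onto a single eigenspace of \<open>L\<close>, since
  projecting onto both gives \<open>0\<close>. Hence a decoder exists as soon as no outcome history is
  compatible with both values of \<open>L\<close> using at most \<open>t\<close> errors each. Given two runs with the same
  history after \<open>k\<close> rounds but opposite values, their numbers of errors (input errors included) add
  up to at least \<open>2 * k + 1\<close>, and to at least \<open>2 * k + 2\<close> if both end with a nontrivial data
  error. Indeed, in each round the last LM outcome is wrong in one of the two runs, which costs an
  error in its QEC or last LM. If QED reports no error, the first LM outcome is wrong in one
  of the runs, which costs an error in its QED or first LM. If QED reports an error, each run
  started the round with a data error or has an error in QED. After \<open>t\<close> rounds the sum exceeds
  \<open>2 * t\<close>.
\<close>

section \<open>Pauli algebra\<close>

abbreviation unit_phases :: "complex set" where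
  "unit_phases \<equiv> {1, -1, \<i>, - \<i>}"

text \<open>Multiplication modulo phase, i.e. the Klein four-group. Dropping the phases makes it
  commutative; they reappear as existentially quantified unit phases.\<close>

fun pauli1_mult :: "pauli1 \<Rightarrow> pauli1 \<Rightarrow> pauli1" where
  "pauli1_mult PI b = b"
| "pauli1_mult a PI = a"
| "pauli1_mult PX PX = PI"
| "pauli1_mult PX PY = PZ"
| "pauli1_mult PX PZ = PY"
| "pauli1_mult PY PX = PZ"
| "pauli1_mult PY PY = PI"
| "pauli1_mult PY PZ = PX"
| "pauli1_mult PZ PX = PY"
| "pauli1_mult PZ PY = PX"
| "pauli1_mult PZ PZ = PI"

definition pauli_mult :: "'q pauli \<Rightarrow> 'q pauli \<Rightarrow> 'q pauli" where
  "pauli_mult P Q = (\<lambda>q. pauli1_mult (P q) (Q q))"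

lemma pauli1_mult_commute: "pauli1_mult a b = pauli1_mult b a"
  by (cases a; cases b) auto

lemma pauli_mult_commute: "pauli_mult P Q = pauli_mult Q P"
  by (simp add: pauli_mult_def pauli1_mult_commute)

lemma unit_phases_mult: "k \<in> unit_phases \<Longrightarrow> l \<in> unit_phases \<Longrightarrow> k * l \<in> unit_phases"
  by auto

lemma unit_phases_inverse: "k \<in> unit_phases \<Longrightarrow> \<exists>l\<in>unit_phases. l * k = 1"
  by auto

text \<open>One phase serves all entries \<open>i\<close>, \<open>j\<close>, so it can be pulled out
  of the product over the qubits.\<close>

lemma pauli1_entry_mult:
  "\<exists>k\<in>unit_phases. \<forall>i j. (\<Sum>x\<in>UNIV. pauli1_entry a i x * pauli1_entry b x j) =
     k * pauli1_entry (pauli1_mult a b) i j"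
  by (cases a; cases b) (simp_all add: UNIV_bool all_bool_eq)

section \<open>Scalar matrices\<close>

lemma mat_mult_nth: "(mat k ** A) $ i $ j = (k::'a::comm_semiring_1) * A $ i $ j"
  by (simp add: matrix_matrix_mult_def mat_def if_distrib[of "\<lambda>x. x * _"] cong: if_cong)

lemma mat_mult_right_nth: "(A ** mat k) $ i $ j = (k::'a::comm_semiring_1) * A $ i $ j"
  by (simp add: matrix_matrix_mult_def mat_def if_distrib[of "\<lambda>x. _ * x"] mult.commute
      cong: if_cong)

lemma mat_commute: "A ** mat k = mat (k::'a::comm_semiring_1) ** A"
  by (simp add: vec_eq_iff mat_mult_nth mat_mult_right_nth)

lemma mat_mult_left_commute: "A ** (mat k ** B) = mat (k::'a::comm_semiring_1) ** (A ** B)"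
  by (metis mat_commute matrix_mul_assoc)

lemma mat_mat: "mat k ** mat l = (mat (k * l) :: 'a::comm_semiring_1 ^ 'n ^ 'n)"
  by (simp only: vec_eq_iff mat_mult_nth) (simp add: mat_def)

lemma mat_mult_mat_mult:
  fixes A B :: "('a::comm_semiring_1) ^ 'n ^ 'n"
  shows "(mat k ** A) ** (mat l ** B) = mat (k * l) ** (A ** B)"
proof -
  have "(mat k ** A) ** (mat l ** B) = mat k ** (A ** (mat l ** B))"
    by (rule matrix_mul_assoc[symmetric])
  also have "\<dots> = mat k ** (mat l ** (A ** B))"
    by (simp only: mat_mult_left_commute[of A l])
  also have "\<dots> = mat (k * l) ** (A ** B)"
    by (simp only: matrix_mul_assoc mat_mat)
  finally show ?thesis .
qed

text \<open>An entry of the product sums, over intermediate basis vectors, a product over qubits. By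
  distributivity this is a product of single-qubit sums, and the overall phase is the product of the
  single-qubit phases.\<close>

lemma pauli_op_mult:
  fixes P Q :: "('q::finite) pauli"
  shows "\<exists>k\<in>unit_phases. pauli_op P ** pauli_op Q = mat k ** pauli_op (pauli_mult P Q)"
proof -
  have "\<forall>q. \<exists>k. k \<in> unit_phases \<and>
      (\<forall>i j. (\<Sum>x\<in>UNIV. pauli1_entry (P q) i x * pauli1_entry (Q q) x j) =
        k * pauli1_entry (pauli1_mult (P q) (Q q)) i j)"
    using pauli1_entry_mult by blast
  then obtain k where k: "\<And>q. k q \<in> unit_phases"
    and eq: "\<And>q i j. (\<Sum>x\<in>UNIV. pauli1_entry (P q) i x * pauli1_entry (Q q) x j) =
        k q * pauli1_entry (pauli1_mult (P q) (Q q)) i j"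
    by metis
  have "(\<Prod>q\<in>A. k q) \<in> unit_phases" for A :: "'q set"
  proof (induction A rule: infinite_finite_induct)
    case (insert q A)
    then show ?case using unit_phases_mult[OF k] by simp
  qed auto
  moreover have "(pauli_op P ** pauli_op Q) $ s $ s' =
      (\<Prod>q\<in>UNIV. k q) * pauli_op (pauli_mult P Q) $ s $ s'" for s s' :: "'q \<Rightarrow> bool"
  proof -
    have "(pauli_op P ** pauli_op Q) $ s $ s' =
        (\<Sum>u\<in>UNIV. \<Prod>q\<in>UNIV. pauli1_entry (P q) (s q) (u q) * pauli1_entry (Q q) (u q) (s' q))"
      by (simp add: matrix_matrix_mult_def pauli_op_def prod.distrib)
    also have "\<dots> = (\<Prod>q\<in>UNIV. \<Sum>x\<in>UNIV.
        pauli1_entry (P q) (s q) x * pauli1_entry (Q q) x (s' q))"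
      using prod_sum_PiE[of "UNIV :: 'q set" "\<lambda>_. UNIV :: bool set"
          "\<lambda>q x. pauli1_entry (P q) (s q) x * pauli1_entry (Q q) x (s' q)"]
      by (simp add: PiE_UNIV_domain)
    also have "\<dots> = (\<Prod>q\<in>UNIV. k q) * pauli_op (pauli_mult P Q) $ s $ s'"
      by (simp add: eq prod.distrib pauli_op_def pauli_mult_def)
    finally show ?thesis .
  qed
  ultimately show ?thesis
    by (intro bexI[of _ "\<Prod>q\<in>UNIV. k q"]) (simp_all add: vec_eq_iff mat_mult_nth)
qed

lemma pauli_op_PI: "pauli_op (\<lambda>q::'q::finite. PI) = mat 1"
proof -
  have "(\<Prod>q\<in>UNIV. pauli1_entry PI (s q) (s' q)) = (if s = s' then 1 else 0)"
    for s s' :: "'q \<Rightarrow> bool"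
    by (auto simp: fun_eq_iff)
  then show ?thesis by (simp add: pauli_op_def mat_def vec_eq_iff)
qed

text \<open>The square of a Pauli operator is a nonzero scalar matrix.\<close>

lemma pauli_op_nonzero: "pauli_op (P :: ('q::finite) pauli) \<noteq> 0"
proof
  assume zero: "pauli_op P = 0"
  have "pauli1_mult a a = PI" for a by (cases a) auto
  then have "pauli_mult P P = (\<lambda>q. PI)" by (simp add: pauli_mult_def)
  then obtain k where "k \<in> unit_phases" "pauli_op P ** pauli_op P = mat k"
    using pauli_op_mult[of P P] by (auto simp: pauli_op_PI mat_mat)
  then have "mat k = pauli_op P ** pauli_op P" and "k \<noteq> 0"
    by auto
  then have eq: "mat k = pauli_op P ** 0"
    by (simp only: zero)
  have "mat k $ (\<lambda>q::'q. True) $ (\<lambda>q::'q. True) = (pauli_op P ** 0) $ (\<lambda>q::'q. True) $ (\<lambda>q::'q. True)"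
    by (rule arg_cong[OF eq, of "\<lambda>A. A $ (\<lambda>q::'q. True) $ (\<lambda>q::'q. True)"])
  then show False using \<open>k \<noteq> 0\<close> by (simp add: mat_def matrix_matrix_mult_def)
qed

text \<open>Both orders are unit phases times the same operator because \<open>pauli_mult\<close> is
  commutative.\<close>

lemma pauli_op_commute_phase:
  "\<exists>k\<in>unit_phases. pauli_op P ** pauli_op Q = mat k ** (pauli_op Q ** pauli_op P)"
proof -
  obtain k where k: "k \<in> unit_phases"
    "pauli_op P ** pauli_op Q = mat k ** pauli_op (pauli_mult P Q)"
    using pauli_op_mult by blast
  obtain l where l: "l \<in> unit_phases"
    "pauli_op Q ** pauli_op P = mat l ** pauli_op (pauli_mult P Q)"
    using pauli_op_mult[of Q P] pauli_mult_commute[of P Q] by metis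
  obtain l' where l': "l' \<in> unit_phases" "l' * l = 1"
    using unit_phases_inverse[OF l(1)] by blast
  have "mat (k * l') ** (pauli_op Q ** pauli_op P) = mat k ** pauli_op (pauli_mult P Q)"
    by (simp add: l(2) matrix_mul_assoc mat_mat mult.assoc l'(2))
  then show ?thesis using k unit_phases_mult[OF k(1) l'(1)] by metis
qed

text \<open>The X part of a product is the exclusive or of the X parts of the factors, so its
  support lies in the union of theirs. The Z part behaves alike.\<close>

lemma x_weight_pauli_mult: "x_weight (pauli_mult P Q) \<le> x_weight P + x_weight Q"
proof -
  have "pauli1_mult a b \<in> {PX, PY} \<Longrightarrow> a \<in> {PX, PY} \<or> b \<in> {PX, PY}" for a b
    by (cases a; cases b) auto
  then have "{q. pauli_mult P Q q \<in> {PX, PY}} \<subseteq> {q. P q \<in> {PX, PY}} \<union> {q. Q q \<in> {PX, PY}}"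
    unfolding pauli_mult_def by blast
  then show ?thesis unfolding x_weight_def
    by (meson card_Un_le card_mono finite order_trans)
qed

lemma z_weight_pauli_mult: "z_weight (pauli_mult P Q) \<le> z_weight P + z_weight Q"
proof -
  have "pauli1_mult a b \<in> {PZ, PY} \<Longrightarrow> a \<in> {PZ, PY} \<or> b \<in> {PZ, PY}" for a b
    by (cases a; cases b) auto
  then have "{q. pauli_mult P Q q \<in> {PZ, PY}} \<subseteq> {q. P q \<in> {PZ, PY}} \<union> {q. Q q \<in> {PZ, PY}}"
    unfolding pauli_mult_def by blast
  then show ?thesis unfolding z_weight_def
    by (meson card_Un_le card_mono finite order_trans)
qed

section \<open>Weights of data errors\<close>

lemma stab_equiv_refl:
  assumes "stabilizer_group S"
  shows "stab_equiv S E E"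
proof -
  have "mat 1 \<in> S" using assms by (simp add: stabilizer_group_def)
  then show ?thesis unfolding stab_equiv_def
    by (intro bexI[of _ "mat 1"] bexI[of _ 1]) auto
qed

lemma err_weight_le:
  "stab_equiv S E E' \<Longrightarrow> x_weight E' \<le> s \<Longrightarrow> z_weight E' \<le> s \<Longrightarrow> err_weight S E \<le> s"
  unfolding err_weight_def by (blast intro: Least_le)

lemma err_weight_witness:
  assumes "stabilizer_group S"
  obtains E' where "stab_equiv S E E'" "x_weight E' \<le> err_weight S E" "z_weight E' \<le> err_weight S E"
proof -
  have "\<exists>s E'. stab_equiv S E E' \<and> x_weight E' \<le> s \<and> z_weight E' \<le> s"
    \<comment> \<open>\<open>E\<close> represents itself, and the maximum of its two weights is an
      admissible \<open>s\<close>.\<close>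
    using stab_equiv_refl[OF assms] by (meson max.cobounded1 max.cobounded2)
  then have "\<exists>E'. stab_equiv S E E' \<and> x_weight E' \<le> err_weight S E \<and> z_weight E' \<le> err_weight S E"
    unfolding err_weight_def by (rule LeastI_ex)
  then show ?thesis using that by blast
qed

lemma err_weight_PI:
  assumes "stabilizer_group S"
  shows "err_weight S (\<lambda>q. PI) = 0"
  using err_weight_le[OF stab_equiv_refl[OF assms], of "\<lambda>q. PI" 0]
  by (simp add: x_weight_def z_weight_def)

text \<open>The stabilizer \<open>h\<close> of the second factor has to move left past
  \<open>E'\<close>. Being a Pauli operator up to phase, it costs only a phase, and the two
  stabilizers combine to \<open>g ** h\<close> in \<open>S\<close>.\<close>

lemma stab_equiv_mult:
  assumes S: "stabilizer_group S" and "stab_equiv S E E'" "stab_equiv S F F'"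
  shows "stab_equiv S (pauli_mult E F) (pauli_mult E' F')"
proof -
  obtain g k where g: "g \<in> S" "k \<in> unit_phases" "pauli_op E = mat k ** (g ** pauli_op E')"
    using assms(2) by (auto simp only: stab_equiv_def)
  obtain h l where h: "h \<in> S" "l \<in> unit_phases" "pauli_op F = mat l ** (h ** pauli_op F')"
    using assms(3) by (auto simp only: stab_equiv_def)
  have gh: "g ** h \<in> S" using S g(1) h(1) by (simp add: stabilizer_group_def)
  have "h \<in> pauli_group" using S h(1) by (auto simp only: stabilizer_group_def)
  then obtain m Q where Q: "h = mat m ** pauli_op Q"
    unfolding pauli_group_def by blast
  obtain n where n: "n \<in> unit_phases"
    "pauli_op E' ** pauli_op Q = mat n ** (pauli_op Q ** pauli_op E')"
    using pauli_op_commute_phase by blast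
  have comm: "pauli_op E' ** h = mat n ** (h ** pauli_op E')"
    unfolding Q using n(2) by (metis mat_commute matrix_mul_assoc)
  obtain a where a: "a \<in> unit_phases" "pauli_op E ** pauli_op F = mat a ** pauli_op (pauli_mult E F)"
    using pauli_op_mult by blast
  obtain b where b: "b \<in> unit_phases"
    "pauli_op E' ** pauli_op F' = mat b ** pauli_op (pauli_mult E' F')"
    using pauli_op_mult by blast
  \<comment> \<open>The phase of \<open>pauli_op E ** pauli_op F\<close> is cancelled at the end by
    this inverse.\<close>
  obtain a' where a': "a' \<in> unit_phases" "a' * a = 1"
    using unit_phases_inverse[OF a(1)] by blast
  have "pauli_op E ** pauli_op F = mat (k * l) ** (g ** (pauli_op E' ** h) ** pauli_op F')"
    unfolding g(3) h(3) mat_mult_mat_mult by (simp add: matrix_mul_assoc)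
  also have "\<dots> = mat (k * l) ** (mat n ** ((g ** h) ** (pauli_op E' ** pauli_op F')))"
    unfolding comm by (simp only: mat_mult_left_commute[of g n] flip: matrix_mul_assoc)
  also have "\<dots> = mat (k * l) ** (mat n ** (mat b ** ((g ** h) ** pauli_op (pauli_mult E' F'))))"
    unfolding b(2)
    by (simp only: mat_mult_left_commute[of h b] mat_mult_left_commute[of g b]
        flip: matrix_mul_assoc)
  also have "\<dots> = mat (k * l * n * b) ** ((g ** h) ** pauli_op (pauli_mult E' F'))"
    by (simp add: matrix_mul_assoc mat_mat mult.assoc)
  finally have "mat a ** pauli_op (pauli_mult E F) =
      mat (k * l * n * b) ** ((g ** h) ** pauli_op (pauli_mult E' F'))"
    using a(2) by simp
  then have "mat a' ** (mat a ** pauli_op (pauli_mult E F)) =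
      mat a' ** (mat (k * l * n * b) ** ((g ** h) ** pauli_op (pauli_mult E' F')))"
    by simp
  then have "pauli_op (pauli_mult E F) =
      mat (a' * (k * l * n * b)) ** ((g ** h) ** pauli_op (pauli_mult E' F'))"
    by (simp add: matrix_mul_assoc mat_mat a'(2))
  moreover have "a' * (k * l * n * b) \<in> unit_phases"
    using a'(1) g(2) h(2) n(1) b(1) by (intro unit_phases_mult)
  ultimately show ?thesis unfolding stab_equiv_def using gh by blast
qed

lemma err_weight_mult:
  assumes "stabilizer_group S"
  shows "err_weight S (pauli_mult E F) \<le> err_weight S E + err_weight S F"
proof -
  obtain E' where E': "stab_equiv S E E'" "x_weight E' \<le> err_weight S E" "z_weight E' \<le> err_weight S E"
    by (rule err_weight_witness[OF assms])
  obtain F' where F': "stab_equiv S F F'" "x_weight F' \<le> err_weight S F" "z_weight F' \<le> err_weight S F"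
    by (rule err_weight_witness[OF assms])
  show ?thesis
    by (rule err_weight_le[OF stab_equiv_mult[OF assms E'(1) F'(1)]])
      (use x_weight_pauli_mult[of E' F'] z_weight_pauli_mult[of E' F'] E' F' in linarith)+
qed

text \<open>An error of weight 0 is a stabilizer up to phase, hence commutes with \<open>L\<close>.
  If it also anticommuted, its product with \<open>L\<close> would vanish, and
  \<open>L ** L = mat 1\<close> would make the error itself 0.\<close>

lemma weightless_not_anticommutes:
  assumes S: "stabilizer_group S" and L: "logical_pauli S L" and "err_weight S E = 0"
  shows "\<not> anticommutes (pauli_op E) L"
proof
  assume anti: "anticommutes (pauli_op E) L"
  obtain E' where E': "stab_equiv S E E'" "x_weight E' \<le> err_weight S E" "z_weight E' \<le> err_weight S E"
    by (rule err_weight_witness[OF S])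
  have "E' q = PI" for q
  proof -
    have "E' q \<notin> {PX, PY}" "E' q \<notin> {PZ, PY}"
      using E'(2,3) assms(3) by (auto simp: x_weight_def z_weight_def)
    then show ?thesis by (cases "E' q") auto
  qed
  then have "pauli_op E' = mat 1" using pauli_op_PI by (metis ext)
  then obtain g k where g: "g \<in> S" "pauli_op E = mat k ** g"
    using E'(1) unfolding stab_equiv_def by (metis matrix_mul_rid)
  have "g ** L = L ** g" and LL: "L ** L = mat 1"
    using L g(1) by (auto simp: logical_pauli_def)
  then have "pauli_op E ** L = L ** pauli_op E"
    unfolding g(2) by (metis mat_commute matrix_mul_assoc)
  with anti have "pauli_op E ** L = - (pauli_op E ** L)"
    by (simp add: anticommutes_def)
  then have "pauli_op E ** L = 0" by (simp add: vec_eq_iff)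
  then have "(pauli_op E ** L) ** L = 0" by (simp add: matrix_matrix_mult_def vec_eq_iff)
  then have "pauli_op E = 0" by (simp add: LL flip: matrix_mul_assoc)
  then show False using pauli_op_nonzero by blast
qed

section \<open>Projectors onto the eigenspaces of the measured operator\<close>

lemma mat_mult_vec: "mat k *v v = (k::'a::comm_semiring_1) *s v"
  by (simp add: vec_eq_iff matrix_vector_mult_def mat_def if_distrib[of "\<lambda>x. x * _"]
      cong: if_cong)

lemma eigenprojector_mult_vec:
  "eigenprojector L b *v \<psi> = (1/2) *s (if b then \<psi> - L *v \<psi> else \<psi> + L *v \<psi>)"
  by (simp add: eigenprojector_def mat_mult_vec matrix_vector_mult_diff_rdistrib
      matrix_vector_mult_add_rdistrib flip: matrix_vector_mul_assoc)

lemma eigenprojector_idem: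
  assumes "logical_pauli S L"
  shows "eigenprojector L b *v (eigenprojector L b *v \<psi>) = eigenprojector L b *v \<psi>"
proof -
  have "L *v (L *v \<psi>) = \<psi>" using assms by (simp add: logical_pauli_def matrix_vector_mul_assoc)
  then show ?thesis
    by (simp add: eigenprojector_mult_vec matrix_vector_right_distrib
        matrix_vector_mult_diff_distrib vector_scalar_commute)
      (simp add: vec_eq_iff)
qed

text \<open>The product of \<open>1 + L\<close> and \<open>1 - L\<close> is
  \<open>1 - L ** L\<close>, which is 0. This excludes runs in which two LM components project onto
  different values.\<close>

lemma eigenprojector_orthogonal:
  assumes "logical_pauli S L" and "b \<noteq> c"
  shows "eigenprojector L b *v (eigenprojector L c *v \<psi>) = 0"
proof -
  have "L *v (L *v \<psi>) = \<psi>" using assms by (simp add: logical_pauli_def matrix_vector_mul_assoc)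
  then show ?thesis using assms(2)
    by (simp add: eigenprojector_mult_vec matrix_vector_right_distrib
        matrix_vector_mult_diff_distrib vector_scalar_commute)
qed

text \<open>\<open>L\<close> commutes with every stabilizer. Component specifications speak of code
  states only, and this invariance lets them apply again after a projection.\<close>

lemma eigenprojector_code_space:
  assumes "logical_pauli S L" and "\<psi> \<in> code_space S"
  shows "eigenprojector L b *v \<psi> \<in> code_space S"
proof -
  have "g *v (L *v \<psi>) = L *v \<psi>" "g *v \<psi> = \<psi>" if "g \<in> S" for g
    using assms that by (simp_all add: logical_pauli_def code_space_def)
      (metis matrix_vector_mul_assoc)
  then show ?thesis
    by (simp add: code_space_def eigenprojector_mult_vec matrix_vector_right_distrib
        matrix_vector_mult_diff_distrib vector_scalar_commute)
qed

section \<open>Sequential composition\<close>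

lemma wf_then_circuit:
  "wf_circuit C \<Longrightarrow> (\<And>r. wf_circuit (D r)) \<Longrightarrow> wf_circuit (then_circuit C D)"
  by (induction C) auto

inductive_cases exec_ReturnE: "exec (Return r) w r' K"
inductive_cases exec_GateE: "exec (Gate A U C) w r K"
inductive_cases exec_PrepE: "exec (Prep q v C) w r K"
inductive_cases exec_MeasE: "exec (Meas q B C) w r K"

text \<open>Every run splits where \<open>C\<close> hands over to \<open>D\<close>; the later map
  multiplies from the left. In the induction the first location, with or without its fault, is put
  back in front of the first part.\<close>

lemma exec_then_circuit:
  "exec (then_circuit C D) w r K \<Longrightarrow>
     \<exists>w1 w2 r1 K1 K2. exec C w1 r1 K1 \<and> exec (D r1) w2 r K2 \<and> w = w1 + w2 \<and> K = K2 ** K1"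
proof (induction C arbitrary: w K)
  case (Return x)
  then show ?case using exec.Return[of x] by (metis add_0 matrix_mul_rid then_circuit.simps(1))
next
  case (Gate A U C)
  from Gate.prems[simplified] show ?case
  proof (cases rule: exec_GateE[consumes 1])
    case (1 K')
    obtain w1 w2 r1 K1 K2 where K: "exec C w1 r1 K1" "exec (D r1) w2 r K2"
      "w = w1 + w2" "K' = K2 ** K1"
      using Gate.IH[OF 1(2)] by blast
    show ?thesis
      by (intro exI conjI, rule exec.Gate[OF K(1)], rule K(2))
        (simp_all add: 1(1) K(3,4) matrix_mul_assoc)
  next
    case (2 w' K' P)
    obtain w1 w2 r1 K1 K2 where K: "exec C w1 r1 K1" "exec (D r1) w2 r K2"
      "w' = w1 + w2" "K' = K2 ** K1"
      using Gate.IH[OF 2(3)] by blast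
    show ?thesis
      by (intro exI conjI, rule exec.Gate_fault[OF K(1) 2(4)], rule K(2))
        (simp_all add: 2(1,2) K(3,4) matrix_mul_assoc)
  qed
next
  case (Prep q v C)
  from Prep.prems[simplified] show ?case
  proof (cases rule: exec_PrepE[consumes 1])
    case (1 K' j)
    obtain w1 w2 r1 K1 K2 where K: "exec C w1 r1 K1" "exec (D r1) w2 r K2"
      "w = w1 + w2" "K' = K2 ** K1"
      using Prep.IH[OF 1(2)] by blast
    show ?thesis
      by (intro exI conjI, rule exec.Prep[OF K(1)], rule K(2))
        (simp_all add: 1(1) K(3,4) matrix_mul_assoc)
  next
    case (2 w' K' P j)
    obtain w1 w2 r1 K1 K2 where K: "exec C w1 r1 K1" "exec (D r1) w2 r K2"
      "w' = w1 + w2" "K' = K2 ** K1"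
      using Prep.IH[OF 2(3)] by blast
    show ?thesis
      by (intro exI conjI, rule exec.Prep_fault[OF K(1) 2(4)], rule K(2))
        (simp_all add: 2(1,2) K(3,4) matrix_mul_assoc)
  qed
next
  case (Meas q B C)
  from Meas.prems[simplified] show ?case
  proof (cases rule: exec_MeasE[consumes 1])
    case (1 b K')
    obtain w1 w2 r1 K1 K2 where K: "exec (C b) w1 r1 K1" "exec (D r1) w2 r K2"
      "w = w1 + w2" "K' = K2 ** K1"
      using Meas.IH[OF rangeI 1(2)] by blast
    show ?thesis
      by (intro exI conjI, rule exec.Meas[of C, OF K(1)], rule K(2))
        (simp_all add: 1(1) K(3,4) matrix_mul_assoc)
  next
    case (2 b w' K')
    obtain w1 w2 r1 K1 K2 where K: "exec (C (\<not> b)) w1 r1 K1" "exec (D r1) w2 r K2"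
      "w' = w1 + w2" "K' = K2 ** K1"
      using Meas.IH[OF rangeI 2(3)] by blast
    show ?thesis
      by (intro exI conjI, rule exec.Meas_fault[of C, OF K(1)], rule K(2))
        (simp_all add: 2(1,2) K(3,4) matrix_mul_assoc)
  qed
qed

text \<open>\<open>run_effect\<close> with the final ancilla state exposed: the next component
  starts from that state, so chaining has to name it.\<close>

definition effect ::
    "('n::finite) operator set \<Rightarrow> ('n + 'a::finite) operator \<Rightarrow> 'n operator \<Rightarrow> 'a state
      \<Rightarrow> 'n operator \<Rightarrow> 'n operator \<Rightarrow> 'a state \<Rightarrow> bool" where
  "effect S K E \<phi> A E' \<phi>' \<longleftrightarrow>
     (\<forall>\<psi>\<in>code_space S. K *v tensor (E *v \<psi>) \<phi> = tensor (E' *v (A *v \<psi>)) \<phi>')"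

lemma run_effect_iff: "run_effect S K E \<phi> A E' \<longleftrightarrow> (\<exists>\<phi>'. effect S K E \<phi> A E' \<phi>')"
  by (simp add: run_effect_def effect_def)

lemma tensor_zero_left: "tensor 0 \<phi> = 0"
  by (simp add: tensor_def vec_eq_iff)

lemma tensor_zero_right: "tensor \<psi> 0 = 0"
  by (simp add: tensor_def vec_eq_iff)

lemma tensor_scale: "tensor (mat k *v \<psi>) \<phi> = tensor \<psi> (mat k *v \<phi>)"
  by (simp add: tensor_def vec_eq_iff mat_mult_vec)

text \<open>The tensor product lets a scalar factor of the data error move into the ancilla
  state.\<close>

lemma effect_phase:
  "effect S K E \<phi> A (mat k ** E') \<phi>' \<Longrightarrow> effect S K E \<phi> A E' (mat k *v \<phi>')"
  by (simp add: effect_def flip: matrix_vector_mul_assoc tensor_scale)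

text \<open>The final ancilla state 0 fits every operation and every data error.\<close>

lemma run_impossible_effect: "run_impossible S K E \<phi> \<Longrightarrow> run_effect S K E \<phi> A E'"
  unfolding run_impossible_def run_effect_def by (metis tensor_zero_right)

text \<open>Used contrapositively: if a run is possible, so is each initial part of it.\<close>

lemma run_impossible_then:
  "run_impossible S K1 E \<phi> \<Longrightarrow> run_impossible S (K2 ** K1) E \<phi>"
  by (simp add: run_impossible_def flip: matrix_vector_mul_assoc)

lemma effect_then:
  assumes "effect S K1 E \<phi> A E1 \<phi>1" "effect S K2 E1 \<phi>1 B E2 \<phi>2"
    and "\<And>\<psi>. \<psi> \<in> code_space S \<Longrightarrow> A *v \<psi> \<in> code_space S"
  shows "effect S (K2 ** K1) E \<phi> (B ** A) E2 \<phi>2"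
  using assms by (simp add: effect_def flip: matrix_vector_mul_assoc)

lemma effect_then_impossible:
  assumes "effect S K1 E \<phi> A E1 \<phi>1" "run_impossible S K2 E1 \<phi>1"
    and "\<And>\<psi>. \<psi> \<in> code_space S \<Longrightarrow> A *v \<psi> \<in> code_space S"
  shows "run_impossible S (K2 ** K1) E \<phi>"
  using assms by (simp add: effect_def run_impossible_def flip: matrix_vector_mul_assoc)

section \<open>Effect of the components on possible runs\<close>

text \<open>Without faults the outcome is flipped only by an incoming error that anticommutes with
  \<open>L\<close>, which weight 0 excludes. The error caused by the faults multiplies the incoming
  one, so the weights at most add up.\<close>

lemma lm_first:
  assumes S: "stabilizer_group S" and L: "logical_pauli S L" and C: "lm_component S L C"
    and ex: "exec C w r K"
  shows "\<exists>c G \<phi>1. effect S K (pauli_op E) \<phi> (eigenprojector L c) (pauli_op G) \<phi>1 \<and>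
     err_weight S G \<le> err_weight S E + w \<and> (w = 0 \<and> err_weight S E = 0 \<longrightarrow> r = c)"
proof -
  obtain c F where F: "err_weight S F \<le> w"
    "run_effect S K (pauli_op E) \<phi> (eigenprojector L c) (pauli_op F ** pauli_op E)"
    "w = 0 \<longrightarrow> r = (c \<noteq> anticommutes (pauli_op E) L)"
    using C ex unfolding lm_component_def by blast
  obtain k where k: "pauli_op F ** pauli_op E = mat k ** pauli_op (pauli_mult F E)"
    using pauli_op_mult by blast
  obtain \<phi>1 where "effect S K (pauli_op E) \<phi> (eigenprojector L c) (pauli_op (pauli_mult F E)) \<phi>1"
    using F(2) effect_phase unfolding run_effect_iff k by blast
  moreover have "err_weight S (pauli_mult F E) \<le> err_weight S E + w"
    using err_weight_mult[OF S, of F E] F(1) by linarith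
  ultimately show ?thesis using F(3) weightless_not_anticommutes[OF S L] by blast
qed

text \<open>The value \<open>c\<close> stays fixed along a possible run: a projection onto the other
  eigenspace after \<open>eigenprojector L c\<close> gives 0.\<close>

lemma lm_next:
  assumes S: "stabilizer_group S" and L: "logical_pauli S L" and C: "lm_component S L C"
    and ex: "exec C w r K2"
    and eff: "effect S K1 E \<phi> (eigenprojector L c) (pauli_op G) \<phi>1"
    and possible: "\<not> run_impossible S (K2 ** K1) E \<phi>"
  shows "\<exists>G' \<phi>2. effect S (K2 ** K1) E \<phi> (eigenprojector L c) (pauli_op G') \<phi>2 \<and>
     err_weight S G' \<le> err_weight S G + w \<and> (w = 0 \<and> err_weight S G = 0 \<longrightarrow> r = c)"
proof -
  obtain b G' \<phi>2 where b: "effect S K2 (pauli_op G) \<phi>1 (eigenprojector L b) (pauli_op G') \<phi>2"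
    "err_weight S G' \<le> err_weight S G + w" "w = 0 \<and> err_weight S G = 0 \<longrightarrow> r = b"
    using lm_first[OF S L C ex] by blast
  have comp: "effect S (K2 ** K1) E \<phi> (eigenprojector L b ** eigenprojector L c) (pauli_op G') \<phi>2"
    using effect_then[OF eff b(1)] eigenprojector_code_space[OF L] by blast
  have "b = c"
  proof (rule ccontr)
    assume "b \<noteq> c"
    then have "run_impossible S (K2 ** K1) E \<phi>"
      using comp by (simp add: effect_def run_impossible_def eigenprojector_orthogonal[OF L]
          tensor_zero_left flip: matrix_vector_mul_assoc)
    with possible show False ..
  qed
  then have "effect S (K2 ** K1) E \<phi> (eigenprojector L c) (pauli_op G') \<phi>2"
    using comp by (simp add: effect_def eigenprojector_idem[OF L] flip: matrix_vector_mul_assoc)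
  then show ?thesis using b \<open>b = c\<close> by blast
qed

text \<open>The bound \<open>w\<close> is free of \<open>err_weight S G\<close>: QEC forgets earlier
  errors, so a data error left after it is charged to QEC itself.\<close>

lemma qec_next:
  assumes L: "logical_pauli S L" and C: "qec_component S t C"
    and ex: "exec C w r K2" and "err_weight S G + w \<le> t"
    and eff: "effect S K1 E \<phi> (eigenprojector L c) (pauli_op G) \<phi>1"
  shows "\<exists>G' \<phi>2. effect S (K2 ** K1) E \<phi> (eigenprojector L c) (pauli_op G') \<phi>2 \<and>
     err_weight S G' \<le> w"
proof -
  obtain G' \<phi>2 where "err_weight S G' \<le> w" "effect S K2 (pauli_op G) \<phi>1 (mat 1) (pauli_op G') \<phi>2"
    using C ex assms(4) unfolding qec_component_def run_effect_iff by blast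
  then show ?thesis
    using effect_then[OF eff] eigenprojector_code_space[OF L] by (metis matrix_mul_lid)
qed

text \<open>The specification makes a wrong report of a fault-free QED impossible, so on a possible
  run the report is exact.\<close>

lemma qed_next:
  assumes L: "logical_pauli S L" and C: "qed_component S t C"
    and ex: "exec C w r K2" and "err_weight S G + w \<le> t"
    and eff: "effect S K1 E \<phi> (eigenprojector L c) (pauli_op G) \<phi>1"
    and possible: "\<not> run_impossible S (K2 ** K1) E \<phi>"
  shows "\<exists>G' \<phi>2. effect S (K2 ** K1) E \<phi> (eigenprojector L c) (pauli_op G') \<phi>2 \<and>
     err_weight S G' \<le> err_weight S G + w \<and> (w = 0 \<longrightarrow> r = (0 < err_weight S G))"
proof -
  obtain G' \<phi>2 where "err_weight S G' \<le> err_weight S G + w"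
    "effect S K2 (pauli_op G) \<phi>1 (mat 1) (pauli_op G') \<phi>2"
    using C ex assms(4) unfolding qed_component_def run_effect_iff by blast
  moreover have "w = 0 \<longrightarrow> r = (0 < err_weight S G)"
  proof (rule ccontr)
    assume "\<not> ?thesis"
    then have "run_impossible S K2 (pauli_op G) \<phi>1"
      using C ex assms(4) unfolding qed_component_def by (metis add_0_right gr0I)
    then show False
      using possible effect_then_impossible[OF eff] eigenprojector_code_space[OF L] by blast
  qed
  ultimately show ?thesis
    using effect_then[OF eff] eigenprojector_code_space[OF L] by (metis matrix_mul_lid)
qed

section \<open>Counting errors\<close>

text \<open>
  Here \<open>c\<close> is the true value, \<open>a\<close> counts the errors so far (including input errors) and \<open>D\<close> tells
  whether a nontrivial data error is present. In a round, \<open>f\<close> counts the errors in QED and the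
  first LM, and \<open>g\<close> those in QEC and the second LM.
\<close>

inductive track :: "bool \<Rightarrow> nat \<Rightarrow> bool list \<Rightarrow> nat \<Rightarrow> bool \<Rightarrow> bool" for c where
  track_0: "(D \<or> m \<noteq> c \<Longrightarrow> 1 \<le> a) \<Longrightarrow> track c 0 [m] a D"
| track_Suc: "track c k h a D \<Longrightarrow> (if e then \<not> D else m \<noteq> c) \<longrightarrow> 1 \<le> f \<Longrightarrow>
    D' \<or> m' \<noteq> c \<longrightarrow> 1 \<le> g \<Longrightarrow> track c (Suc k) (h @ [e, m, m']) (a + f + g) D'"

lemma track_0_iff: "track c 0 h a D \<longleftrightarrow> (\<exists>m. h = [m] \<and> (D \<or> m \<noteq> c \<longrightarrow> 1 \<le> a))"
  by (subst track.simps) auto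

inductive_cases track_SucE: "track c (Suc k) h a D"

text \<open>The \<open>of_bool\<close> term carries the induction: if QED reports an error and both
  runs entered the round with one, neither has to pay in QED or the first LM, and the missing unit
  comes from the induction hypothesis.\<close>

lemma track_opposite_values:
  "track False k h a D \<Longrightarrow> track True k h a' D' \<Longrightarrow> 2 * k + 1 + of_bool (D \<and> D') \<le> a + a'"
proof (induction k arbitrary: h a D a' D')
  case 0
  then show ?case by (auto simp: track_0_iff)
next
  case (Suc k)
  obtain h0 a0 D0 e m m' f g where x: "h = h0 @ [e, m, m']" "a = a0 + f + g"
    "track False k h0 a0 D0"
    "(if e then \<not> D0 else m \<noteq> False) \<longrightarrow> 1 \<le> f" "D \<or> m' \<noteq> False \<longrightarrow> 1 \<le> g"
    using Suc.prems(1) by (elim track_SucE) (rule that, assumption+, simp_all)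
  obtain h1 a1 D1 e1 m1 m1' f' g' where y': "h = h1 @ [e1, m1, m1']" "a' = a1 + f' + g'"
    "track True k h1 a1 D1"
    "(if e1 then \<not> D1 else m1 \<noteq> True) \<longrightarrow> 1 \<le> f'" "D' \<or> m1' \<noteq> True \<longrightarrow> 1 \<le> g'"
    using Suc.prems(2) by (elim track_SucE) (rule that, assumption+, simp_all)
  have "h1 = h0" "e1 = e" "m1 = m" "m1' = m'" using x(1) y'(1) by auto
  note y = y'[unfolded this]
  \<comment> \<open>The common outcome \<open>m'\<close> is wrong for one of the two values, which
    costs that run an error; a final data error in both runs costs each of them one.\<close>
  have "1 + of_bool (D \<and> D') \<le> g + g'"
    using x(5) y(5) by (cases m') auto
  moreover have "2 * k + 2 \<le> a0 + a1 + (f + f')"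
    using Suc.IH[OF x(3) y(3)] x(4) y(4) by (auto split: if_splits)
  ultimately show ?case using x(2) y(2) by simp
qed

text \<open>The components are followed in temporal order with one value \<open>c\<close>. The
  weight bound is carried along because it meets the input conditions of QED and QEC;
  \<open>track\<close> keeps what the counting uses.\<close>

lemma lm_qed_rounds_track:
  assumes S: "stabilizer_group S" and L: "logical_pauli S L"
    and LM: "\<And>i. lm_component S L (LM i)"
    and QEC: "\<And>i. qec_component S t (QEC i)"
    and QED: "\<And>i. qed_component S t (QED i)"
  shows "exec (lm_qed_rounds LM QED QEC k) w h K \<Longrightarrow> err_weight S E + w \<le> t \<Longrightarrow>
    \<not> run_impossible S K (pauli_op E) \<phi> \<Longrightarrow>
    \<exists>c G \<phi>'. effect S K (pauli_op E) \<phi> (eigenprojector L c) (pauli_op G) \<phi>' \<and>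
      err_weight S G \<le> err_weight S E + w \<and>
      track c k h (err_weight S E + w) (0 < err_weight S G)"
proof (induction k arbitrary: w h K)
  case 0
  obtain m where m: "exec (LM 0) w m K" "h = [m]"
    using exec_then_circuit[OF 0(1)[unfolded lm_qed_rounds.simps]]
    by (auto elim!: exec_ReturnE)
  obtain c G \<phi>' where "effect S K (pauli_op E) \<phi> (eigenprojector L c) (pauli_op G) \<phi>'"
    "err_weight S G \<le> err_weight S E + w" "w = 0 \<and> err_weight S E = 0 \<longrightarrow> m = c"
    using lm_first[OF S L LM m(1)] by blast
  then show ?case unfolding track_0_iff m(2)
    by (intro exI[of _ c] exI[of _ G] exI[of _ \<phi>']) auto
next
  case (Suc k)
  \<comment> \<open>The components are split off one by one; each \<open>v\<close> and
    \<open>J\<close> are the error count and the map of the remaining run.\<close>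
  obtain w0 h0 K0 v0 J0 where 0: "exec (lm_qed_rounds LM QED QEC k) w0 h0 K0"
    "exec (then_circuit (QED k) (\<lambda>e.
       then_circuit (LM (2 * k + 1)) (\<lambda>m.
       then_circuit (QEC k) (\<lambda>_.
       then_circuit (LM (2 * k + 2)) (\<lambda>m'.
       Return (h0 @ [e, m, m'])))))) v0 h J0"
    "w = w0 + v0" "K = J0 ** K0"
    using exec_then_circuit[OF Suc.prems(1)[unfolded lm_qed_rounds.simps]] by blast
  obtain w1 e K1 v1 J1 where 1: "exec (QED k) w1 e K1"
    "exec (then_circuit (LM (2 * k + 1)) (\<lambda>m.
       then_circuit (QEC k) (\<lambda>_.
       then_circuit (LM (2 * k + 2)) (\<lambda>m'.
       Return (h0 @ [e, m, m']))))) v1 h J1"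
    "v0 = w1 + v1" "J0 = J1 ** K1"
    using exec_then_circuit[OF 0(2)] by blast
  obtain w2 m K2 v2 J2 where 2: "exec (LM (2 * k + 1)) w2 m K2"
    "exec (then_circuit (QEC k) (\<lambda>_.
       then_circuit (LM (2 * k + 2)) (\<lambda>m'.
       Return (h0 @ [e, m, m'])))) v2 h J2"
    "v1 = w2 + v2" "J1 = J2 ** K2"
    using exec_then_circuit[OF 1(2)] by blast
  obtain w3 K3 v3 J3 u where 3: "exec (QEC k) w3 u K3"
    "exec (then_circuit (LM (2 * k + 2)) (\<lambda>m'. Return (h0 @ [e, m, m']))) v3 h J3"
    "v2 = w3 + v3" "J2 = J3 ** K3"
    using exec_then_circuit[OF 2(2)] by blast
  obtain m' where 4: "exec (LM (2 * k + 2)) v3 m' J3" "h = h0 @ [e, m, m']"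
    using exec_then_circuit[OF 3(2)] by (auto elim!: exec_ReturnE)
  have w: "w = w0 + w1 + w2 + w3 + v3" and K: "K = J3 ** (K3 ** (K2 ** (K1 ** K0)))"
    by (simp_all add: 0 1 2 3 matrix_mul_assoc)
  have p3: "\<not> run_impossible S (K3 ** (K2 ** (K1 ** K0))) (pauli_op E) \<phi>"
    using Suc.prems(3) run_impossible_then unfolding K by blast
  have p2: "\<not> run_impossible S (K2 ** (K1 ** K0)) (pauli_op E) \<phi>"
    using p3 run_impossible_then by blast
  have p1: "\<not> run_impossible S (K1 ** K0) (pauli_op E) \<phi>"
    using p2 run_impossible_then by blast
  have p0: "\<not> run_impossible S K0 (pauli_op E) \<phi>"
    using p1 run_impossible_then by blast
  have t: "err_weight S E + w0 + w1 + w2 + w3 + v3 \<le> t"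
    using Suc.prems(2) w by simp
  then have t0: "err_weight S E + w0 \<le> t" by simp
  obtain c G0 \<phi>0 where G0: "effect S K0 (pauli_op E) \<phi> (eigenprojector L c) (pauli_op G0) \<phi>0"
    "err_weight S G0 \<le> err_weight S E + w0"
    "track c k h0 (err_weight S E + w0) (0 < err_weight S G0)"
    using Suc.IH[OF 0(1) t0 p0] by blast
  have t1: "err_weight S G0 + w1 \<le> t" using G0(2) t by simp
  obtain G1 \<phi>1 where G1:
    "effect S (K1 ** K0) (pauli_op E) \<phi> (eigenprojector L c) (pauli_op G1) \<phi>1"
    "err_weight S G1 \<le> err_weight S G0 + w1" "w1 = 0 \<longrightarrow> e = (0 < err_weight S G0)"
    using qed_next[OF L QED 1(1) t1 G0(1) p1] by blast
  obtain G2 \<phi>2 where G2: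
    "effect S (K2 ** (K1 ** K0)) (pauli_op E) \<phi> (eigenprojector L c) (pauli_op G2) \<phi>2"
    "err_weight S G2 \<le> err_weight S G1 + w2" "w2 = 0 \<and> err_weight S G1 = 0 \<longrightarrow> m = c"
    using lm_next[OF S L LM 2(1) G1(1) p2] by blast
  have t3: "err_weight S G2 + w3 \<le> t" using G0(2) G1(2) G2(2) t by simp
  obtain G3 \<phi>3 where G3:
    "effect S (K3 ** (K2 ** (K1 ** K0))) (pauli_op E) \<phi> (eigenprojector L c) (pauli_op G3) \<phi>3"
    "err_weight S G3 \<le> w3"
    using qec_next[OF L QEC 3(1) t3 G2(1)] by blast
  obtain G4 \<phi>4 where G4: "effect S K (pauli_op E) \<phi> (eigenprojector L c) (pauli_op G4) \<phi>4"
    "err_weight S G4 \<le> err_weight S G3 + v3" "v3 = 0 \<and> err_weight S G3 = 0 \<longrightarrow> m' = c"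
    using lm_next[OF S L LM 4(1) G3(1)] Suc.prems(3) unfolding K by blast
  \<comment> \<open>Without errors in QED and the first LM, \<open>e\<close> is exact; if it is
    false, the data error has weight 0 up to that LM, whose outcome is then
    \<open>c\<close>.\<close>
  have "(if e then \<not> 0 < err_weight S G0 else m \<noteq> c) \<longrightarrow> 1 \<le> w1 + w2"
    using G1(2,3) G2(3) by (cases "w1 = 0") auto
  \<comment> \<open>Without errors in QEC and the last LM, QEC leaves weight 0 whatever came before,
    so the last LM is correct and leaves weight 0 too.\<close>
  moreover have "0 < err_weight S G4 \<or> m' \<noteq> c \<longrightarrow> 1 \<le> w3 + v3"
    using G3(2) G4(2,3) by (cases "w3 + v3 = 0") auto
  ultimately have "track c (Suc k) h (err_weight S E + w0 + (w1 + w2) + (w3 + v3))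
      (0 < err_weight S G4)"
    unfolding 4(2) by (rule track_Suc[OF G0(3)])
  then have "track c (Suc k) h (err_weight S E + w) (0 < err_weight S G4)"
    by (simp add: w add.assoc)
  moreover have "err_weight S G4 \<le> err_weight S E + w"
    using G4(2) G3(2) w by simp
  ultimately show ?case using G4(1) by blast
qed

section \<open>Existence of the decoder\<close>

lemma wf_lm_qed_rounds:
  assumes "\<And>i. wf_circuit (LM i)" "\<And>i. wf_circuit (QED i)" "\<And>i. wf_circuit (QEC i)"
  shows "wf_circuit (lm_qed_rounds LM QED QEC k)"
  by (induction k) (simp_all add: wf_then_circuit assms)

theorem theorem15:
  fixes t d :: nat
    and S :: "('n::finite) operator set"
    and L :: "'n operator"
    and LM QED :: "nat \<Rightarrow> ('n + 'a::finite, bool) circuit"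
    and QEC :: "nat \<Rightarrow> ('n + 'a, unit) circuit"
  assumes "t \<ge> 1" and "d = 2 * t + 1"
    and "stabilizer_group S"
    and "logical_pauli S L"
    and "\<And>i. lm_component S L (LM i)"
    and "\<And>i. qec_component S t (QEC i)"
    and "\<And>i. qed_component S t (QED i)"
  shows "\<exists>decoder. ft_logical_measurement S L t
           (decoded_procedure LM QED QEC ((d - 1) div 2) decoder)"
proof -
  \<comment> \<open>The answer is \<open>True\<close> exactly when the history is compatible with
    the value \<open>True\<close> at a cost of at most \<open>t\<close> errors.\<close>
  define decoder where "decoder h \<longleftrightarrow> (\<exists>a D. a \<le> t \<and> track True t h a D)" for h
  have wf: "wf_circuit (decoded_procedure LM QED QEC t decoder)"
    unfolding decoded_procedure_def using assms(5-7)
    by (intro wf_then_circuit wf_lm_qed_rounds)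
      (simp_all add: lm_component_def qec_component_def qed_component_def)
  have "\<exists>E'. err_weight S E' \<le> t \<and>
      run_effect S K (pauli_op E) \<phi> (eigenprojector L r) (pauli_op E')"
    if ex: "exec (decoded_procedure LM QED QEC t decoder) w r K" and le: "err_weight S E + w \<le> t"
    for w r K E \<phi>
  proof (cases "run_impossible S K (pauli_op E) \<phi>")
    case True
    \<comment> \<open>A run of probability zero admits any final error; the identity, of weight 0,
      is taken.\<close>
    then show ?thesis
      using run_impossible_effect err_weight_PI[OF assms(3)] by (metis le0)
  next
    case False
    obtain h where h: "exec (lm_qed_rounds LM QED QEC t) w h K" "r = decoder h"
      using exec_then_circuit[OF ex[unfolded decoded_procedure_def]]
      by (auto elim!: exec_ReturnE)
    obtain c G \<phi>' where G: "effect S K (pauli_op E) \<phi> (eigenprojector L c) (pauli_op G) \<phi>'"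
      "err_weight S G \<le> err_weight S E + w"
      "track c t h (err_weight S E + w) (0 < err_weight S G)"
      using lm_qed_rounds_track[OF assms(3-7) h(1) le False] by blast
    have "decoder h = c"
    proof (cases c)
      case True
      then have "track True t h (err_weight S E + w) (0 < err_weight S G)" using G(3) by simp
      then have "decoder h" unfolding decoder_def using le by blast
      then show ?thesis using True by simp
    next
      case False
      \<comment> \<open>Tracks of one history with opposite values need at least
        \<open>2 * t + 1\<close> errors in total, but at most \<open>t\<close> each are
        available.\<close>
      have "\<not> (a \<le> t \<and> track True t h a D)" for a D
        using track_opposite_values[of t h _ _ a D] G(3) False le by fastforce
      then have "\<not> decoder h" unfolding decoder_def by blast
      then show ?thesis using False by simp
    qed
    then show ?thesis using G(1,2) le h(2) unfolding run_effect_iff by (intro exI[of _ G]) auto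
  qed
  then have "ft_logical_measurement S L t (decoded_procedure LM QED QEC t decoder)"
    unfolding ft_logical_measurement_def using wf by blast
  then show ?thesis using assms(2) by auto
qed

end
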